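(* If $\Gamma$ is a countable group, then $\mathbb{C}(\Gamma)$ is amenable as a $\mathbb{C}$-algebra if and only if $\Gamma$ is an amenable group. Moreover, $\Gamma$ acts on $l^2(\Gamma)$ in an algebraically amenable fashion.
   Context: $\mathbb{C}(\Gamma)$ denotes the complex group algebra of $\Gamma$, and amenability of the group $\Gamma$ is the usual amenability of discrete groups. A unital $k$-algebra $\mathcal{A}$ over a commutative field $k$ is amenable if for any finite subset $\{r_1,\dots,r_n\}\subset\mathcal{A}$ and any real number $\epsilon>0$ there exists a finite dimensional $k$-subspace $V\subset\mathcal{A}$ such that $\frac{\dim_k(\sum_{i=1}^n r_iV)}{\dim_k V}<1+\epsilon$. A representation $\phi:\Gamma\to GL(V)$ of a discrete group $\Gamma$ on a vector space $V$ over $k$ is algebraically amenable if for any $g_1,\dots,g_m\in\Gamma$ and $\epsilon>0$ there exists a finite dimensional vector space $W\subseteq V$ such that $\frac{\dim_k(\sum_{i=1}^m g_iW)}{\dim_k(W)}\le 1+\epsilon$. In the statement, $k=\mathbb{C}$ and $V=l^2(\Gamma)$, the Hilbert space of square-summable complex functions on $\Gamma$, on which $\Gamma$ acts by translations $(\gamma f)(\delta)=f(\gamma^{-1}\delta)$.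
   Formalization: The "Moreover" sentence fails for non-amenable countable groups such as the free group on two generators; it is stated and proved as: Γ acts on l^2(Γ) in an algebraically amenable fashion if and only if Γ is amenable. *)

theory Defs
  imports
    "HOL-Analysis.Analysis"
    "HOL-Library.Poly_Mapping"
    "HOL-Library.Function_Algebras"
begin

text \<open>
  Groups are types of class \<^class>\<open>group_add\<close>, the class of not necessarily commutative groups.
  It is written additively: \<open>g + h\<close> is the group product, \<open>0\<close> the neutral element and \<open>- g\<close>
  the inverse.
\<close>

subsection \<open>Amenable algebras\<close>

locale unital_algebra = vector_space scale
  for scale :: "'k::field \<Rightarrow> 'a::ring_1 \<Rightarrow> 'a" +
  assumes scale_mult_left: "scale c x * y = scale c (x * y)"
    and scale_mult_right: "x * scale c y = scale c (x * y)"
begin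

text \<open>
  The sum of the subspaces \<open>r V\<close> is the span of their union. The condition \<open>dim V > 0\<close> is needed
  because \<open>0 / 0 = 0\<close> in HOL, so that the zero subspace would otherwise always qualify.
\<close>

definition amenable :: bool where
  "amenable \<longleftrightarrow>
    (\<forall>F \<epsilon>. finite F \<and> (\<epsilon>::real) > 0 \<longrightarrow>
      (\<exists>V. subspace V \<and> (\<exists>B. finite B \<and> span B = V) \<and> dim V > 0 \<and>
        real (dim (span (\<Union>r\<in>F. (*) r ` V))) / real (dim V) < 1 + \<epsilon>))"

end

subsection \<open>Algebraically amenable representations\<close>

text \<open>The space \<open>V\<close> of the representation is a subspace of the ambient type \<open>'v\<close>.\<close>

locale linear_representation = vector_space scale
  for scale :: "'k::field \<Rightarrow> 'v::ab_group_add \<Rightarrow> 'v" +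
  fixes V :: "'v set"
    and act :: "'g::group_add \<Rightarrow> 'v \<Rightarrow> 'v"
  assumes subspace_V: "subspace V"
    and act_closed: "v \<in> V \<Longrightarrow> act g v \<in> V"
    and act_add: "v \<in> V \<Longrightarrow> w \<in> V \<Longrightarrow> act g (v + w) = act g v + act g w"
    and act_scale: "v \<in> V \<Longrightarrow> act g (scale c v) = scale c (act g v)"
    and act_zero: "v \<in> V \<Longrightarrow> act 0 v = v"
    and act_plus: "v \<in> V \<Longrightarrow> act (g + h) v = act g (act h v)"
begin

definition algebraically_amenable :: bool where
  "algebraically_amenable \<longleftrightarrow>
    (\<forall>S \<epsilon>. finite S \<and> (\<epsilon>::real) > 0 \<longrightarrow>
      (\<exists>W. subspace W \<and> W \<subseteq> V \<and> (\<exists>B. finite B \<and> span B = W) \<and> dim W > 0 \<and>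
        real (dim (span (\<Union>g\<in>S. act g ` W))) / real (dim W) \<le> 1 + \<epsilon>))"

end

subsection \<open>Amenable groups\<close>

text \<open>A left-invariant finitely additive probability measure on all subsets of the group.\<close>

definition amenable_group :: "'g::group_add itself \<Rightarrow> bool" where
  "amenable_group _ \<longleftrightarrow>
    (\<exists>\<mu> :: 'g set \<Rightarrow> real.
      (\<forall>A. 0 \<le> \<mu> A) \<and> \<mu> UNIV = 1 \<and>
      (\<forall>A B. A \<inter> B = {} \<longrightarrow> \<mu> (A \<union> B) = \<mu> A + \<mu> B) \<and>
      (\<forall>g A. \<mu> ((+) g ` A) = \<mu> A))"

subsection \<open>The complex group algebra\<close>

text \<open>
  Multiplication on \<^typ>\<open>'g \<Rightarrow>\<^sub>0 complex\<close> is convolution,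
  \<open>single g a * single h b = single (g + h) (a * b)\<close>, also for noncommutative \<^typ>\<open>'g\<close>.
\<close>

type_synonym 'g group_algebra = "'g \<Rightarrow>\<^sub>0 complex"

definition group_algebra_scale :: "complex \<Rightarrow> 'g group_algebra \<Rightarrow> 'g group_algebra" where
  "group_algebra_scale c = Poly_Mapping.map ((*) c)"

lemma lookup_group_algebra_scale:
  "Poly_Mapping.lookup (group_algebra_scale c p) g = c * Poly_Mapping.lookup p g"
  by (simp add: group_algebra_scale_def Poly_Mapping.map.rep_eq when_def)

lemma group_algebra_scale_eq_mult:
  "group_algebra_scale c p = Poly_Mapping.single (0::'g::group_add) c * p"
  by (simp add: group_algebra_scale_def mult_map_scale_conv_mult)

lemma single_zero_commute:
  fixes p :: "'g::group_add group_algebra"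
  shows "p * Poly_Mapping.single 0 c = Poly_Mapping.single 0 c * p"
proof (rule poly_mapping_eqI)
  fix k
  have *: "((c when b = 0) when k = a + b) = ((c when a = k) when b = 0)" for a b :: 'g
    by (auto simp: when_def)
  have "Poly_Mapping.lookup (p * Poly_Mapping.single 0 c) k = Poly_Mapping.lookup p k * c"
    by (simp add: lookup_mult lookup_single * mult_when)
  then show "Poly_Mapping.lookup (p * Poly_Mapping.single 0 c) k =
      Poly_Mapping.lookup (Poly_Mapping.single 0 c * p) k"
    by (simp flip: group_algebra_scale_eq_mult add: lookup_group_algebra_scale)
qed

interpretation group_algebra:
  unital_algebra "group_algebra_scale :: complex \<Rightarrow> 'g::group_add group_algebra \<Rightarrow> 'g group_algebra"
proof
  fix a b :: complex and x y :: "'g group_algebra"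
  show "group_algebra_scale a (x + y) = group_algebra_scale a x + group_algebra_scale a y"
    by (rule poly_mapping_eqI) (simp add: lookup_group_algebra_scale lookup_add algebra_simps)
  show "group_algebra_scale (a + b) x = group_algebra_scale a x + group_algebra_scale b x"
    by (rule poly_mapping_eqI) (simp add: lookup_group_algebra_scale lookup_add algebra_simps)
  show "group_algebra_scale a (group_algebra_scale b x) = group_algebra_scale (a * b) x"
    by (rule poly_mapping_eqI) (simp add: lookup_group_algebra_scale)
  show "group_algebra_scale 1 x = x"
    by (rule poly_mapping_eqI) (simp add: lookup_group_algebra_scale)
  show "group_algebra_scale a x * y = group_algebra_scale a (x * y)"
    by (simp add: group_algebra_scale_eq_mult mult.assoc)
  show "x * group_algebra_scale a y = group_algebra_scale a (x * y)"
    by (metis group_algebra_scale_eq_mult mult.assoc single_zero_commute)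
qed

subsection \<open>The regular representation\<close>

definition fun_scale :: "complex \<Rightarrow> ('g \<Rightarrow> complex) \<Rightarrow> 'g \<Rightarrow> complex" where
  "fun_scale c f = (\<lambda>x. c * f x)"

definition l2 :: "('g \<Rightarrow> complex) set" where
  "l2 = {f. (\<lambda>x. (cmod (f x))\<^sup>2) summable_on UNIV}"

definition translation :: "'g::group_add \<Rightarrow> ('g \<Rightarrow> complex) \<Rightarrow> 'g \<Rightarrow> complex" where
  "translation g f = (\<lambda>x. f (- g + x))"

interpretation l2: linear_representation fun_scale l2 "translation :: 'g::group_add \<Rightarrow> _"
proof -
  interpret vs: vector_space "fun_scale :: complex \<Rightarrow> ('g \<Rightarrow> complex) \<Rightarrow> _"
    by unfold_locales (auto simp: fun_scale_def fun_eq_iff algebra_simps)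
  have bound: "(cmod (a + b))\<^sup>2 \<le> 2 * (cmod a)\<^sup>2 + 2 * (cmod b)\<^sup>2" for a b :: complex
  proof -
    have "(cmod (a + b))\<^sup>2 \<le> (cmod a + cmod b)\<^sup>2"
      by (intro power_mono norm_triangle_ineq norm_ge_zero)
    also have "\<dots> \<le> 2 * (cmod a)\<^sup>2 + 2 * (cmod b)\<^sup>2"
      using zero_le_power2[of "cmod a - cmod b"] by (simp add: power2_eq_square algebra_simps)
    finally show ?thesis .
  qed
  show "linear_representation fun_scale l2 (translation :: 'g \<Rightarrow> _)"
  proof
    show "vs.subspace l2"
    proof (rule vs.subspaceI)
      show "0 \<in> (l2 :: ('g \<Rightarrow> complex) set)" by (simp add: l2_def)
    next
      fix f h :: "'g \<Rightarrow> complex" assume "f \<in> l2" "h \<in> l2"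
      then have "(\<lambda>x. 2 * (cmod (f x))\<^sup>2 + 2 * (cmod (h x))\<^sup>2) summable_on UNIV"
        by (intro summable_on_add summable_on_cmult_right) (auto simp: l2_def)
      then have "(\<lambda>x. (cmod (f x + h x))\<^sup>2) summable_on UNIV"
        by (rule summable_on_comparison_test) (use bound in auto)
      then show "f + h \<in> l2" by (simp add: l2_def)
    next
      fix c and f :: "'g \<Rightarrow> complex" assume "f \<in> l2"
      then show "fun_scale c f \<in> l2"
        by (auto simp: l2_def fun_scale_def norm_mult power_mult_distrib
            intro!: summable_on_cmult_right)
    qed
  next
    fix g :: 'g and f :: "'g \<Rightarrow> complex" assume f: "f \<in> l2"
    have "bij ((+) (- g))"
      by (rule bij_betw_byWitness[where f' = "(+) g"]) (auto simp flip: add.assoc)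
    with f show "translation g f \<in> l2"
      using summable_on_reindex_bij_betw[of "(+) (- g)" UNIV UNIV "\<lambda>x. (cmod (f x))\<^sup>2"]
      by (simp add: l2_def translation_def)
  qed (auto simp: translation_def fun_scale_def fun_eq_iff minus_add add.assoc
      simp del: add_uminus_conv_diff)
qed

end

theory Submission
  imports Defs
begin

text \<open>
  The two equivalences follow from one cycle: \<open>\<Gamma>\<close> amenable \<open>\<Rightarrow>\<close> Folner condition \<open>\<Rightarrow>\<close> \<open>\<complex>\<Gamma>\<close> amenable
  \<open>\<Rightarrow>\<close> \<open>l\<^sup>2(\<Gamma>)\<close> algebraically amenable \<open>\<Rightarrow>\<close> \<open>\<Gamma>\<close> amenable.

  If the Folner condition fails, some finite \<open>K\<close> satisfies \<open>|KA| \<ge> 2|A|\<close> for all finite \<open>A\<close>. By the marriage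
  theorem, \<open>\<Gamma> \<times> {0,1}\<close> then embeds into \<open>\<Gamma>\<close> moving every point by an element of \<open>K\<close>, and such a paradoxical
  decomposition excludes an invariant mean. A Folner set spans a witness for the amenability of the
  group algebra, which sits equivariantly in \<open>l\<^sup>2(\<Gamma>)\<close>.

  For the last step, let \<open>P\<close> be the orthogonal projection onto a finite dimensional \<open>W \<subseteq> l\<^sup>2(\<Gamma>)\<close> and consider the
  probability measure \<open>\<mu>(A) = tr(P 1\<^sub>A) / dim W\<close>. The diagonal of \<open>P\<close> increases with \<open>W\<close>, has total mass \<open>dim W\<close> and is
  equivariant. Comparing \<open>W\<close> and \<open>g W\<close> with their sum shows that \<open>\<mu>\<close> is almost invariant if that sum
  is hardly larger than \<open>W\<close>. An invariant mean then exists by compactness of \<open>[0,1]\<close>-valued set functions.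
\<close>

subsection \<open>The marriage theorem and the Folner condition\<close>

text \<open>A relation serves as a bipartite graph. Since \<open>card\<close> is 0 on infinite sets,
  this is Hall's condition for relations with finite fibres, and finiteness is assumed
  separately.\<close>

definition hall_condition :: "('a \<times> 'b) set \<Rightarrow> bool" where
  "hall_condition R \<longleftrightarrow> (\<forall>Y. finite Y \<longrightarrow> card Y \<le> card (R `` Y))"

text \<open>If both deletions failed, there would be sets \<open>Y\<close> and \<open>Z\<close>
  avoiding \<open>x\<close> whose enlarged images \<open>?P\<close> and \<open>?Q\<close> have at
  most \<open>card Y\<close> and \<open>card Z\<close> elements. But \<open>?P \<union> ?Q\<close>
  is the image of \<open>Y \<union> Z\<close> together with \<open>x\<close>, and
  \<open>?P \<inter> ?Q\<close> contains the image of \<open>Y \<inter> Z\<close>, so counting union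
  and intersection gives one element too many.\<close>

lemma hall_condition_delete:
  assumes fin: "\<And>x. finite (R `` {x})" and hall: "hall_condition R"
    and a: "(x, a) \<in> R" and b: "(x, b) \<in> R" and "a \<noteq> b"
  shows "hall_condition (R - {(x, a)}) \<or> hall_condition (R - {(x, b)})"
proof (rule ccontr)
  have finI: "finite (R' `` Y)" if "finite Y" "R' \<subseteq> R" for Y R'
  proof -
    have "R' `` Y \<subseteq> (\<Union>y\<in>Y. R `` {y})"
      using that(2) by auto
    then show ?thesis
      using that(1) fin by (meson finite_UN finite_subset)
  qed
  \<comment> \<open>A set that violates the condition after the deletion must contain
    \<open>x\<close>, as its image has changed. Dropping \<open>x\<close> from it turns the strict
    inequality into a weak one.\<close>
  have key: "\<exists>Y. finite Y \<and> x \<notin> Y \<and> card (R `` Y \<union> (R `` {x} - {c})) \<le> card Y"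
    if "\<not> hall_condition (R - {(x, c)})" for c
  proof -
    obtain Z where Z: "finite Z" "card ((R - {(x, c)}) `` Z) < card Z"
      using \<open>\<not> hall_condition _\<close> by (auto simp: hall_condition_def not_le)
    have "x \<in> Z"
    proof (rule ccontr)
      assume "x \<notin> Z"
      then have "(R - {(x, c)}) `` Z = R `` Z" by auto
      with Z hall show False by (simp add: hall_condition_def leD)
    qed
    have "R `` (Z - {x}) \<union> (R `` {x} - {c}) \<subseteq> (R - {(x, c)}) `` Z"
      using \<open>x \<in> Z\<close> by auto
    then have "card (R `` (Z - {x}) \<union> (R `` {x} - {c})) \<le> card ((R - {(x, c)}) `` Z)"
      by (intro card_mono finI Z) auto
    also have "\<dots> \<le> card (Z - {x})"
      using Z \<open>x \<in> Z\<close> by (simp add: card_Diff_singleton)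
    finally show ?thesis
      using Z(1) by (intro exI[of _ "Z - {x}"]) auto
  qed
  assume "\<not> (hall_condition (R - {(x, a)}) \<or> hall_condition (R - {(x, b)}))"
  then obtain Y Z where Y: "finite Y" "x \<notin> Y" "card (R `` Y \<union> (R `` {x} - {a})) \<le> card Y"
    and Z: "finite Z" "x \<notin> Z" "card (R `` Z \<union> (R `` {x} - {b})) \<le> card Z"
    using key by meson
  let ?P = "R `` Y \<union> (R `` {x} - {a})" and ?Q = "R `` Z \<union> (R `` {x} - {b})"
  have fins: "finite ?P" "finite ?Q"
    using finI[OF Y(1)] finI[OF Z(1)] fin by auto
  have "?P \<union> ?Q = R `` insert x (Y \<union> Z)"
    using \<open>a \<noteq> b\<close> by auto
  then have "card (insert x (Y \<union> Z)) \<le> card (?P \<union> ?Q)"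
    using hall Y Z by (simp only: hall_condition_def finite_insert finite_Un)
  moreover have "card (Y \<inter> Z) \<le> card (?P \<inter> ?Q)"
  proof -
    have "card (Y \<inter> Z) \<le> card (R `` (Y \<inter> Z))"
      using hall Y(1) by (simp add: hall_condition_def)
    also have "\<dots> \<le> card (?P \<inter> ?Q)"
      using fins by (intro card_mono) auto
    finally show ?thesis .
  qed
  ultimately show False
    using card_Un_Int[OF fins] card_Un_Int[OF Y(1) Z(1)] Y Z by simp
qed

text \<open>Rado's argument: a minimal relation satisfying the condition is a function.\<close>

theorem hall_infinite:
  assumes fin: "\<And>x. finite (R `` {x})" and hall: "hall_condition R"
  shows "\<exists>f. inj f \<and> (\<forall>x. (x, f x) \<in> R)"
proof -
  \<comment> \<open>Zorn's lemma is applied to the sets of deleted pairs, so that the upper bound of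
    a chain is its union.\<close>
  define \<A> where "\<A> = {D. D \<subseteq> R \<and> hall_condition (R - D)}"
  have "\<exists>M\<in>\<A>. \<forall>X\<in>\<A>. M \<subseteq> X \<longrightarrow> X = M"
  proof (rule subset_Zorn_nonempty)
    show "\<A> \<noteq> {}" using hall by (auto simp: \<A>_def intro!: exI[of _ "{}"])
  next
    fix C assume C: "C \<noteq> {}" "subset.chain \<A> C"
    have "hall_condition (R - \<Union>C)"
      unfolding hall_condition_def
    proof (intro allI impI)
      fix Y :: "'a set" assume "finite Y"
      \<comment> \<open>Only finitely many pairs of \<open>R\<close> start in \<open>Y\<close>, so a
        single member of the chain contains all of them that \<open>\<Union>C\<close>
        deletes.\<close>
      let ?E = "Sigma Y (\<lambda>y. R `` {y}) \<inter> \<Union>C"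
      have "finite ?E" using \<open>finite Y\<close> fin by auto
      then obtain D where D: "D \<in> C" "?E \<subseteq> D"
        using finite_subset_Union_chain[of ?E C \<A>] C by auto
      then have "(R - D) `` Y = (R - \<Union>C) `` Y" by auto
      moreover have "hall_condition (R - D)"
        using C(2) D(1) by (auto simp: subset.chain_def \<A>_def)
      ultimately show "card Y \<le> card ((R - \<Union>C) `` Y)"
        using \<open>finite Y\<close> unfolding hall_condition_def by metis
    qed
    then show "\<Union>C \<in> \<A>" using C(2) by (auto simp: subset.chain_def \<A>_def)
  qed
  then obtain M where M: "M \<subseteq> R" "hall_condition (R - M)"
    and maximal: "\<And>X. X \<in> \<A> \<Longrightarrow> M \<subseteq> X \<Longrightarrow> X = M"
    by (auto simp: \<A>_def)
  have finM: "finite ((R - M) `` {x})" for x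
    using fin[of x] by (rule rev_finite_subset) auto
  have unique: "a = b" if "(x, a) \<in> R - M" "(x, b) \<in> R - M" for x a b
  proof (rule ccontr)
    assume "a \<noteq> b"
    have "\<not> hall_condition (R - M - {(x, c)})" if "(x, c) \<in> R - M" for c
    proof
      assume "hall_condition (R - M - {(x, c)})"
      moreover have "R - M - {(x, c)} = R - insert (x, c) M" by auto
      ultimately have "insert (x, c) M \<in> \<A>" using M(1) that by (simp add: \<A>_def)
      then show False using maximal that by blast
    qed
    then show False
      using hall_condition_delete[OF finM M(2) that \<open>a \<noteq> b\<close>] that by blast
  qed
  have "\<exists>a. (x, a) \<in> R - M" for x
  proof -
    have "card {x} \<le> card ((R - M) `` {x})"
      using M(2) by (simp only: hall_condition_def finite.intros)
    then show ?thesis by (cases "(R - M) `` {x} = {}") auto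
  qed
  then obtain f where f: "(x, f x) \<in> R - M" for x by metis
  have "inj f"
  proof (rule injI, rule ccontr)
    fix x y assume "f x = f y" "x \<noteq> y"
    have "(R - M) `` {x, y} = {f x}"
      using f[of x] f[of y] unique \<open>f x = f y\<close> by auto
    moreover have "card {x, y} \<le> card ((R - M) `` {x, y})"
      using M(2) by (simp only: hall_condition_def finite.intros)
    ultimately show False using \<open>x \<noteq> y\<close> by simp
  qed
  with f show ?thesis by auto
qed

section \<open>Invariant means and the Folner condition\<close>

definition folner :: "'g::group_add itself \<Rightarrow> bool" where
  "folner _ \<longleftrightarrow> (\<forall>(K::'g set) \<epsilon>. finite K \<and> (\<epsilon>::real) > 0 \<longrightarrow>
    (\<exists>A. finite A \<and> A \<noteq> {} \<and> real (card (\<Union>k\<in>K. (+) k ` A)) < (1 + \<epsilon>) * real (card A)))"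

text \<open>Expansion compounds when \<open>L\<close> is the set of \<open>n\<close>-fold products
  from \<open>K\<close>. This serves to raise a factor 1 + \<epsilon> above 2.\<close>

lemma expansion_iterate:
  fixes K :: "'g::group_add set" and c :: real
  assumes "finite K" "c \<ge> 0"
    and exp: "\<And>A. finite A \<Longrightarrow> c * real (card A) \<le> real (card (\<Union>k\<in>K. (+) k ` A))"
  shows "\<exists>L :: 'g set. finite L \<and>
    (\<forall>A. finite A \<longrightarrow> c ^ n * real (card A) \<le> real (card (\<Union>k\<in>L. (+) k ` A)))"
proof (induction n)
  case 0
  then show ?case by (intro exI[of _ "{0}"]) simp
next
  case (Suc n)
  then obtain L :: "'g set" where L: "finite L"
    "\<And>A. finite A \<Longrightarrow> c ^ n * real (card A) \<le> real (card (\<Union>k\<in>L. (+) k ` A))" by auto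
  have "c ^ Suc n * real (card A) \<le> real (card (\<Union>k\<in>(\<Union>k\<in>K. (+) k ` L). (+) k ` A))"
    if "finite A" for A
  proof -
    have eq: "(\<Union>k\<in>(\<Union>k\<in>K. (+) k ` L). (+) k ` A) = (\<Union>k\<in>K. (+) k ` (\<Union>k\<in>L. (+) k ` A))"
      by (auto simp: add.assoc image_iff)
    have "c ^ Suc n * real (card A) \<le> c * real (card (\<Union>k\<in>L. (+) k ` A))"
      using mult_left_mono[OF L(2)[OF that] \<open>c \<ge> 0\<close>] by (simp add: mult.assoc)
    also have "\<dots> \<le> real (card (\<Union>k\<in>K. (+) k ` (\<Union>k\<in>L. (+) k ` A)))"
      using that L(1) by (intro exp) auto
    finally show ?thesis unfolding eq .
  qed
  then show ?case
    using \<open>finite K\<close> L(1) by (intro exI[of _ "\<Union>k\<in>K. (+) k ` L"]) simp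
qed

text \<open>Without Folner sets some finite \<open>L\<close> more than doubles every nonempty finite
  set, which is Hall's condition for two copies of the group. The resulting injection cuts both
  copies into finitely many pieces with pairwise disjoint translates, of total measure 2.\<close>

lemma amenable_group_imp_folner:
  assumes "amenable_group TYPE('g::group_add)"
  shows "folner TYPE('g)"
proof (rule ccontr)
  obtain \<mu> :: "'g set \<Rightarrow> real" where \<mu>: "\<And>A. 0 \<le> \<mu> A" "\<mu> UNIV = 1"
    "\<And>A B. A \<inter> B = {} \<Longrightarrow> \<mu> (A \<union> B) = \<mu> A + \<mu> B" "\<And>g A. \<mu> ((+) g ` A) = \<mu> A"
    using assms unfolding amenable_group_def by auto
  assume "\<not> folner TYPE('g)"
  then obtain K :: "'g set" and \<epsilon> :: real where K: "finite K" "\<epsilon> > 0"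
    "\<And>A. finite A \<Longrightarrow> A \<noteq> {} \<Longrightarrow> (1 + \<epsilon>) * real (card A) \<le> real (card (\<Union>k\<in>K. (+) k ` A))"
    unfolding folner_def by (auto simp: not_less)
  then have K3: "(1 + \<epsilon>) * real (card A) \<le> real (card (\<Union>k\<in>K. (+) k ` A))" if "finite A" for A
    using that by (cases "A = {}") auto
  obtain n where n: "2 < (1 + \<epsilon>) ^ n"
    using real_arch_pow[of "1 + \<epsilon>" 2] K(2) by auto
  obtain L :: "'g set" where L: "finite L"
    "\<And>A. finite A \<Longrightarrow> (1 + \<epsilon>) ^ n * real (card A) \<le> real (card (\<Union>k\<in>L. (+) k ` A))"
    using expansion_iterate[OF K(1) _ K3, of n] K(2) by auto
  \<comment> \<open>Both copies of \<open>x\<close> are offered the same candidates, the elements of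
    \<open>L\<close> times \<open>x\<close>.\<close>
  define R where "R = {((x, i::bool), y). \<exists>k\<in>L. y = k + x}"
  have "finite (R `` {p})" for p
  proof -
    have "R `` {p} \<subseteq> (\<lambda>k. k + fst p) ` L" by (auto simp: R_def)
    then show ?thesis using L(1) finite_surj by blast
  qed
  moreover have "hall_condition R"
    unfolding hall_condition_def
  proof (intro allI impI)
    fix Y :: "('g \<times> bool) set" assume Y: "finite Y"
    have "card Y \<le> card (fst ` Y \<times> (UNIV :: bool set))"
      using Y by (intro card_mono) (auto simp: image_iff, force)
    then have "real (card Y) \<le> 2 * real (card (fst ` Y))"
      by (simp add: card_cartesian_product)
    also have "\<dots> \<le> (1 + \<epsilon>) ^ n * real (card (fst ` Y))"
      using n by (intro mult_right_mono) auto
    also have "\<dots> \<le> real (card (\<Union>k\<in>L. (+) k ` fst ` Y))"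
      using Y by (intro L) auto
    also have "(\<Union>k\<in>L. (+) k ` fst ` Y) = R `` Y"
      by (force simp: R_def image_iff)
    finally show "card Y \<le> card (R `` Y)" by simp
  qed
  ultimately obtain f where f: "inj f" "\<And>p. (p, f p) \<in> R"
    using hall_infinite by metis
  then have "\<exists>k. k \<in> L \<and> f p = k + fst p" for p
    using f(2)[of p] by (cases p) (auto simp: R_def)
  then obtain t where t: "\<And>p. t p \<in> L" "\<And>p. f p = t p + fst p" by metis
  \<comment> \<open>\<open>A (i, k)\<close> collects the points whose copy \<open>i\<close> is moved
    by \<open>k\<close>. For fixed \<open>i\<close> these pieces partition the group.\<close>
  define A where "A = (\<lambda>(i, k). {x. t (x, i) = k})"
  have empty: "\<mu> {} = 0" using \<mu>(3)[of "{}" "{}"] by simp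
  have sum: "\<mu> (\<Union>j\<in>J. B j) = (\<Sum>j\<in>J. \<mu> (B j))"
    if "finite J" "disjoint_family_on B J" for J :: "'j set" and B
    using that
  proof (induction J rule: finite_induct)
    case empty
    then show ?case using \<open>\<mu> {} = 0\<close> by simp
  next
    case (insert j J)
    then have "B j \<inter> (\<Union>j\<in>J. B j) = {}" by (auto simp: disjoint_family_on_def)
    then show ?case
      using insert \<mu>(3) disjoint_family_on_mono[OF subset_insertI insert.prems] by simp
  qed
  have total: "(\<Sum>k\<in>L. \<mu> (A (i, k))) = 1" for i
  proof -
    have "(\<Union>k\<in>L. A (i, k)) = UNIV" using t(1) by (auto simp: A_def)
    moreover have "disjoint_family_on (\<lambda>k. A (i, k)) L"
      by (auto simp: A_def disjoint_family_on_def)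
    ultimately show ?thesis using sum[OF L(1)] \<mu>(2) by metis
  qed
  \<comment> \<open>On this piece \<open>f\<close> is translation by \<open>snd j\<close>, so
    disjointness of the translates reduces to injectivity of \<open>f\<close>.\<close>
  have image: "(+) (snd j) ` A j = f ` (A j \<times> {fst j})" for j
    by (force simp: A_def t(2) split: prod.splits)
  have "disjoint_family_on (\<lambda>j. (+) (snd j) ` A j) (UNIV \<times> L)"
    unfolding disjoint_family_on_def image image_Int[OF f(1), symmetric]
    by (auto simp: A_def)
  then have "\<mu> (\<Union>j\<in>UNIV \<times> L. (+) (snd j) ` A j) = (\<Sum>j\<in>UNIV \<times> L. \<mu> ((+) (snd j) ` A j))"
    using L(1) by (intro sum) auto
  also have "\<dots> = (\<Sum>i\<in>UNIV. \<Sum>k\<in>L. \<mu> (A (i, k)))"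
    by (simp add: \<mu>(4) sum.cartesian_product)
  also have "\<dots> = 2" by (simp add: total UNIV_bool)
  finally have "\<mu> (\<Union>j\<in>UNIV \<times> L. (+) (snd j) ` A j) = 2" .
  moreover have "\<mu> B \<le> 1" for B
    using \<mu>(1)[of "- B"] \<mu>(2) \<mu>(3)[of B "- B"] by simp
  from this[of "\<Union>j\<in>UNIV \<times> L. (+) (snd j) ` A j"]
  have "\<mu> (\<Union>j\<in>UNIV \<times> L. (+) (snd j) ` A j) \<le> 1" .
  ultimately show False by linarith
qed

subsection \<open>From Folner sets to algebraic amenability\<close>

text \<open>Reduces questions about these spans to containment of supports, both for independence
  and for products.\<close>

lemma group_algebra_span_single:
  "group_algebra.span ((\<lambda>a. Poly_Mapping.single a 1) ` A) = {p. Poly_Mapping.keys p \<subseteq> A}"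
    (is "group_algebra.span (?s ` A) = ?V")
proof
  have "group_algebra.subspace ?V"
  proof (rule group_algebra.subspaceI)
    fix p q :: "'a group_algebra" assume "p \<in> ?V" "q \<in> ?V"
    then show "p + q \<in> ?V" using Poly_Mapping.keys_add[of p q] by blast
  next
    fix c and p :: "'a group_algebra" assume "p \<in> ?V"
    then show "group_algebra_scale c p \<in> ?V"
      by (auto simp: in_keys_iff lookup_group_algebra_scale)
  qed simp
  then show "group_algebra.span (?s ` A) \<subseteq> ?V"
    by (intro group_algebra.span_minimal) auto
  show "?V \<subseteq> group_algebra.span (?s ` A)"
  proof
    fix p :: "'a group_algebra" assume "p \<in> ?V"
    have "p = (\<Sum>a\<in>Poly_Mapping.keys p. group_algebra_scale (Poly_Mapping.lookup p a) (?s a))"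
      by (rule poly_mapping_eqI)
        (simp add: lookup_sum lookup_group_algebra_scale lookup_single when_def if_distrib
          in_keys_iff cong: if_cong)
    also have "\<dots> \<in> group_algebra.span (?s ` A)"
      using \<open>p \<in> ?V\<close>
      by (intro group_algebra.span_sum group_algebra.span_scale group_algebra.span_base) auto
    finally show "p \<in> group_algebra.span (?s ` A)" .
  qed
qed

lemma inj_single_one: "inj (\<lambda>a. Poly_Mapping.single a (1::complex))"
  by (rule injI) (metis keys_single singleton_inject zero_neq_one)

lemma group_algebra_independent_single:
  "group_algebra.independent ((\<lambda>a::'g::group_add. Poly_Mapping.single a 1) ` A)"
proof -
  let ?s = "\<lambda>a::'g. Poly_Mapping.single a (1::complex)"
  have "?s a \<notin> group_algebra.span (?s ` A - {?s a})" if "a \<in> A" for a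
  proof -
    have "?s ` A - {?s a} = ?s ` (A - {a})"
      using inj_single_one by (auto simp: inj_def)
    then show ?thesis by (simp add: group_algebra_span_single)
  qed
  then show ?thesis by (auto simp: group_algebra.dependent_def)
qed

text \<open>With \<open>K\<close> the union of the supports of the elements of \<open>F\<close>,
  multiplication by \<open>F\<close> sends elements supported in \<open>A\<close> to elements
  supported in \<open>?KA\<close>. Dimensions are thus bounded by the cardinalities in the Folner
  condition.\<close>

lemma folner_imp_group_algebra_amenable:
  assumes "folner TYPE('g::group_add)"
  shows "group_algebra.amenable TYPE('g)"
  unfolding group_algebra.amenable_def
proof (intro allI impI, elim conjE)
  fix F :: "'g group_algebra set" and \<epsilon> :: real assume "finite F" "\<epsilon> > 0"
  let ?s = "\<lambda>a::'g. Poly_Mapping.single a (1::complex)"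
  define K where "K = (\<Union>r\<in>F. Poly_Mapping.keys r)"
  have "finite K" using \<open>finite F\<close> by (simp add: K_def)
  then obtain A :: "'g set" where A: "finite A" "A \<noteq> {}"
    "real (card (\<Union>k\<in>K. (+) k ` A)) < (1 + \<epsilon>) * real (card A)"
    using assms \<open>\<epsilon> > 0\<close> unfolding folner_def by meson
  let ?KA = "\<Union>k\<in>K. (+) k ` A"
  let ?V = "group_algebra.span (?s ` A)"
  have card_s: "card (?s ` B) = card B" for B
    using inj_single_one by (metis card_image inj_on_subset subset_UNIV)
  have dim: "group_algebra.dim ?V = card A"
    by (metis group_algebra.dim_span_eq_card_independent group_algebra_independent_single card_s)
  have "(\<Union>r\<in>F. (*) r ` ?V) \<subseteq> group_algebra.span (?s ` ?KA)"
  proof -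
    have "Poly_Mapping.keys (r * p) \<subseteq> ?KA" if "r \<in> F" "Poly_Mapping.keys p \<subseteq> A" for r p
      using keys_mult[of r p] that by (fastforce simp: K_def)
    then show ?thesis unfolding group_algebra_span_single by blast
  qed
  then have "group_algebra.span (\<Union>r\<in>F. (*) r ` ?V) \<subseteq> group_algebra.span (?s ` ?KA)"
    by (metis group_algebra.span_minimal group_algebra.subspace_span)
  then have "group_algebra.dim (group_algebra.span (\<Union>r\<in>F. (*) r ` ?V)) \<le> card (?s ` ?KA)"
    using A(1) \<open>finite K\<close> by (intro group_algebra.dim_le_card) auto
  then have "real (group_algebra.dim (group_algebra.span (\<Union>r\<in>F. (*) r ` ?V))) < (1 + \<epsilon>) * real (card A)"
    using A(3) by (simp only: card_s)
  moreover have "card A > 0" using A by (simp add: card_gt_0_iff)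
  ultimately have "real (group_algebra.dim (group_algebra.span (\<Union>r\<in>F. (*) r ` ?V)))
      / real (group_algebra.dim ?V) < 1 + \<epsilon>"
    unfolding dim by (simp add: divide_less_eq)
  then show "\<exists>V. group_algebra.subspace V \<and> (\<exists>B. finite B \<and> group_algebra.span B = V) \<and>
      group_algebra.dim V > 0 \<and>
      real (group_algebra.dim (group_algebra.span (\<Union>r\<in>F. (*) r ` V))) / real (group_algebra.dim V) < 1 + \<epsilon>"
    using dim \<open>card A > 0\<close> A(1)
    by (intro exI[of _ ?V]) (auto intro!: exI[of _ "?s ` A"])
qed

section \<open>The equivariant embedding of the group algebra into the regular
  representation\<close>

lemma lookup_single_mult:
  fixes p :: "'g::group_add group_algebra"
  shows "Poly_Mapping.lookup (Poly_Mapping.single g 1 * p) =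
    translation g (Poly_Mapping.lookup p)"
proof
  fix x
  have "(Poly_Mapping.lookup p b when x = a + b) = (Poly_Mapping.lookup p b when b = - a + x)"
    for a b
    by (auto simp: when_def simp flip: add.assoc)
  then show "Poly_Mapping.lookup (Poly_Mapping.single g 1 * p) x =
      translation g (Poly_Mapping.lookup p) x"
    by (simp add: lookup_mult lookup_single when_mult translation_def)
qed

lemma lookup_in_l2: "Poly_Mapping.lookup p \<in> l2"
proof -
  have "(\<lambda>x. (cmod (Poly_Mapping.lookup p x))\<^sup>2) summable_on Poly_Mapping.keys p"
    by (rule summable_on_finite) simp
  then show ?thesis
    unfolding l2_def mem_Collect_eq
    by (rule summable_on_cong_neutral[THEN iffD1, rotated -1]) (auto simp: in_keys_iff)
qed

lemma linear_lookup:
  "Vector_Spaces.linear group_algebra_scale fun_scale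
    (Poly_Mapping.lookup :: 'g::group_add group_algebra \<Rightarrow> _)"
  by unfold_locales
    (auto simp: lookup_add lookup_group_algebra_scale fun_scale_def fun_eq_iff algebra_simps)

lemma dim_lookup_image:
  "l2.dim (Poly_Mapping.lookup ` X) = group_algebra.dim X"
proof -
  interpret lookup: Vector_Spaces.linear group_algebra_scale fun_scale
    "Poly_Mapping.lookup :: 'a group_algebra \<Rightarrow> _"
    by (rule linear_lookup)
  obtain C where C: "C \<subseteq> X" "group_algebra.independent C" "X \<subseteq> group_algebra.span C"
    "card C = group_algebra.dim X"
    using group_algebra.basis_exists by blast
  have inj: "inj_on Poly_Mapping.lookup Y" for Y :: "'a group_algebra set"
    by (simp add: inj_on_def poly_mapping_eqI)
  show ?thesis
  proof (rule l2.dim_unique)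
    show "Poly_Mapping.lookup ` C \<subseteq> Poly_Mapping.lookup ` X" using C(1) by blast
    show "Poly_Mapping.lookup ` X \<subseteq> l2.span (Poly_Mapping.lookup ` C)"
      using C(3) unfolding lookup.span_image by blast
    show "l2.independent (Poly_Mapping.lookup ` C)"
      using C(2) inj by (rule lookup.independent_injective_image)
    show "card (Poly_Mapping.lookup ` C) = group_algebra.dim X"
      using C(4) card_image[OF inj] by metis
  qed
qed

text \<open>Amenability of the algebra is applied to the group elements in \<open>S\<close>. The map
  \<open>lookup\<close> is linear, injective and turns left multiplication by them into translation,
  so both dimensions carry over.\<close>

lemma group_algebra_amenable_imp_l2:
  assumes "group_algebra.amenable TYPE('g::group_add)"
  shows "l2.algebraically_amenable TYPE('g)"
  unfolding l2.algebraically_amenable_def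
proof (intro allI impI, elim conjE)
  fix S :: "'g set" and \<epsilon> :: real assume "finite S" "\<epsilon> > 0"
  interpret lookup: Vector_Spaces.linear group_algebra_scale fun_scale
    "Poly_Mapping.lookup :: 'g group_algebra \<Rightarrow> _"
    by (rule linear_lookup)
  define F where "F = (\<lambda>g. Poly_Mapping.single g (1::complex)) ` S"
  have "finite F" using \<open>finite S\<close> by (simp add: F_def)
  then obtain V B where V: "group_algebra.subspace V" "finite B" "group_algebra.span B = V"
    "group_algebra.dim V > 0"
    "real (group_algebra.dim (group_algebra.span (\<Union>r\<in>F. (*) r ` V))) / real (group_algebra.dim V) < 1 + \<epsilon>"
    using assms \<open>\<epsilon> > 0\<close> unfolding group_algebra.amenable_def by meson
  let ?W = "Poly_Mapping.lookup ` V"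
  have "(\<Union>g\<in>S. translation g ` ?W) = Poly_Mapping.lookup ` (\<Union>r\<in>F. (*) r ` V)"
    by (simp add: F_def image_UN image_image lookup_single_mult)
  then have "l2.dim (l2.span (\<Union>g\<in>S. translation g ` ?W)) =
      group_algebra.dim (group_algebra.span (\<Union>r\<in>F. (*) r ` V))"
    by (simp only: lookup.span_image dim_lookup_image)
  moreover have "l2.span (Poly_Mapping.lookup ` B) = ?W"
    using V(3) by (simp add: lookup.span_image)
  ultimately show "\<exists>W. l2.subspace W \<and> W \<subseteq> l2 \<and> (\<exists>B. finite B \<and> l2.span B = W) \<and> l2.dim W > 0 \<and>
      real (l2.dim (l2.span (\<Union>g\<in>S. translation g ` W))) / real (l2.dim W) \<le> 1 + \<epsilon>"
    using V lookup_in_l2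
    by (intro exI[of _ ?W] conjI exI[of _ "Poly_Mapping.lookup ` B"])
      (auto simp: dim_lookup_image lookup.subspace_image)
qed

subsection \<open>Orthogonal projections in the regular representation\<close>

text \<open>Linear in the first argument. A sum that does not converge is 0 by convention, hence the
  membership hypotheses in the lemmas below.\<close>

definition l2_inner :: "('g \<Rightarrow> complex) \<Rightarrow> ('g \<Rightarrow> complex) \<Rightarrow> complex" where
  "l2_inner f h = (\<Sum>\<^sub>\<infinity>x. f x * cnj (h x))"

lemma l2_mult_cnj_summable:
  assumes "f \<in> l2" "h \<in> l2"
  shows "(\<lambda>x. f x * cnj (h x)) summable_on UNIV"
proof (rule abs_summable_summable)
  have "(\<lambda>x. (cmod (f x))\<^sup>2 + (cmod (h x))\<^sup>2) summable_on UNIV"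
    using assms by (intro summable_on_add) (auto simp: l2_def)
  then show "(\<lambda>x. cmod (f x * cnj (h x))) summable_on UNIV"
  proof (rule summable_on_comparison_test)
    fix x
    \<comment> \<open>Expanding the square gives twice the desired inequality.\<close>
    have "0 \<le> (cmod (f x) - cmod (h x))\<^sup>2 + cmod (f x) ^ 2 + cmod (h x) ^ 2" by simp
    then show "cmod (f x * cnj (h x)) \<le> (cmod (f x))\<^sup>2 + (cmod (h x))\<^sup>2"
      by (simp add: norm_mult power2_eq_square algebra_simps)
  qed simp
qed

lemma l2_inner_add:
  assumes "f \<in> l2" "f' \<in> l2" "h \<in> l2"
  shows "l2_inner (f + f') h = l2_inner f h + l2_inner f' h"
  using infsum_add[OF l2_mult_cnj_summable l2_mult_cnj_summable, OF assms(1,3,2,3)]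
  by (simp add: l2_inner_def algebra_simps)

lemma l2_inner_scale: "l2_inner (fun_scale c f) h = c * l2_inner f h"
  by (simp add: l2_inner_def fun_scale_def mult.assoc infsum_cmult_right')

lemma l2_inner_commute: "l2_inner f h = cnj (l2_inner h f)"
  by (simp add: l2_inner_def mult.commute flip: infsum_cnj)

lemma l2_inner_self:
  assumes "f \<in> l2"
  shows "l2_inner f f = complex_of_real (\<Sum>\<^sub>\<infinity>x. (cmod (f x))\<^sup>2)"
proof -
  have "((\<lambda>x. (cmod (f x))\<^sup>2) has_sum (\<Sum>\<^sub>\<infinity>x. (cmod (f x))\<^sup>2)) UNIV"
    using assms by (simp add: l2_def)
  from has_sum_of_real[OF this, where ?'a = complex] have "((\<lambda>x. f x * cnj (f x)) has_sum
      complex_of_real (\<Sum>\<^sub>\<infinity>x. (cmod (f x))\<^sup>2)) UNIV"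
    by (simp only: complex_norm_square)
  then show ?thesis unfolding l2_inner_def by (rule infsumI)
qed

lemma l2_inner_self_eq_0:
  assumes "f \<in> l2" "l2_inner f f = 0"
  shows "f = 0"
proof
  fix x
  have "(\<Sum>\<^sub>\<infinity>x. (cmod (f x))\<^sup>2) = 0" using assms by (simp add: l2_inner_self)
  moreover have "(\<lambda>x. (cmod (f x))\<^sup>2) summable_on UNIV" using assms(1) by (simp add: l2_def)
  ultimately have "(cmod (f x))\<^sup>2 = 0"
    using nonneg_infsum_le_0D[of "\<lambda>x. (cmod (f x))\<^sup>2" UNIV x] by simp
  then show "f x = 0 x" by simp
qed

lemma l2_sum_closed:
  fixes e :: "'i \<Rightarrow> 'g::group_add \<Rightarrow> complex"
  assumes "\<And>i. i \<in> I \<Longrightarrow> e i \<in> l2"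
  shows "(\<Sum>i\<in>I. fun_scale (c i) (e i)) \<in> l2"
  using assms by (auto intro!: l2.subspace_sum l2.subspace_scale l2.subspace_V)

lemma l2_inner_sum:
  fixes e :: "'i \<Rightarrow> 'g::group_add \<Rightarrow> complex"
  assumes "\<And>i. i \<in> I \<Longrightarrow> e i \<in> l2" "h \<in> l2"
  shows "l2_inner (\<Sum>i\<in>I. fun_scale (c i) (e i)) h = (\<Sum>i\<in>I. c i * l2_inner (e i) h)"
  using assms(1)
proof (induction I rule: infinite_finite_induct)
  case (insert i I)
  then show ?case
    using l2_sum_closed[of I e c] l2.subspace_scale[OF l2.subspace_V, of "e i"]
    by (simp add: l2_inner_add l2_inner_scale assms(2) del: plus_fun_apply func_plus)
qed (simp_all add: l2_inner_def)

section \<open>Finite orthonormal families and diagonals of projections\<close>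

definition orthonormal :: "('g::group_add \<Rightarrow> complex) set \<Rightarrow> bool" where
  "orthonormal E \<longleftrightarrow> finite E \<and> E \<subseteq> l2 \<and>
    (\<forall>e\<in>E. \<forall>e'\<in>E. l2_inner e e' = (if e = e' then 1 else 0))"

lemma orthonormal_coefficient:
  assumes "orthonormal E" "e \<in> E"
  shows "l2_inner (\<Sum>e\<in>E. fun_scale (c e) e) e = c e"
proof -
  have "l2_inner (\<Sum>e\<in>E. fun_scale (c e) e) e = (\<Sum>e'\<in>E. c e' * l2_inner e' e)"
    using assms by (intro l2_inner_sum) (auto simp: orthonormal_def)
  also have "\<dots> = (\<Sum>e'\<in>E. if e' = e then c e' else 0)"
    using assms by (intro sum.cong) (auto simp: orthonormal_def)
  also have "\<dots> = c e" using assms by (simp add: orthonormal_def)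
  finally show ?thesis .
qed

lemma orthonormal_expansion:
  assumes "orthonormal E" "f \<in> l2.span E"
  shows "f = (\<Sum>e\<in>E. fun_scale (l2_inner f e) e)"
proof -
  obtain c where c: "f = (\<Sum>e\<in>E. fun_scale (c e) e)"
    using assms l2.span_finite[of E] by (auto simp: orthonormal_def)
  have "l2_inner f e = c e" if "e \<in> E" for e
    unfolding c using assms(1) that by (rule orthonormal_coefficient)
  with c show ?thesis by simp
qed

lemma parseval:
  assumes "orthonormal E"
  shows "l2_inner (\<Sum>e\<in>E. fun_scale (c e) e) (\<Sum>e\<in>E. fun_scale (c e) e)
    = complex_of_real (\<Sum>e\<in>E. (cmod (c e))\<^sup>2)"
proof -
  let ?f = "\<Sum>e\<in>E. fun_scale (c e) e"
  have "l2_inner ?f ?f = (\<Sum>e\<in>E. c e * l2_inner e ?f)"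
    using assms by (intro l2_inner_sum l2_sum_closed) (auto simp: orthonormal_def)
  also have "\<dots> = (\<Sum>e\<in>E. c e * cnj (c e))"
    by (intro sum.cong refl, subst l2_inner_commute, subst orthonormal_coefficient[OF assms]) auto
  finally show ?thesis by (simp add: complex_norm_square[symmetric])
qed

text \<open>
  The value at \<open>x\<close> is the diagonal matrix entry of the orthogonal projection onto the span of \<open>E\<close>,
  so it depends on that span only and is monotone in it.
\<close>

definition proj_diag :: "('g::group_add \<Rightarrow> complex) set \<Rightarrow> 'g \<Rightarrow> real" where
  "proj_diag E x = (\<Sum>e\<in>E. (cmod (e x))\<^sup>2)"

lemma proj_diag_nonneg: "0 \<le> proj_diag E x"
  by (simp add: proj_diag_def sum_nonneg)

lemma sum_fun_scale_apply: "(\<Sum>i\<in>I. fun_scale (c i) (e i)) x = (\<Sum>i\<in>I. c i * e i x)"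
  by (induction I rule: infinite_finite_induct) (auto simp: fun_scale_def)

text \<open>Let \<open>f\<close> be the projection of the point mass at \<open>x\<close> to the span
  of \<open>E\<close>. Its value at \<open>x\<close> and its squared norm both equal
  \<open>proj_diag E x\<close>. Expanding \<open>f\<close> in \<open>D\<close>, Cauchy-Schwarz
  bounds the square of this number by its product with \<open>proj_diag D x\<close>.\<close>

lemma proj_diag_mono:
  assumes E: "orthonormal E" and D: "orthonormal D" and sub: "E \<subseteq> l2.span D"
  shows "proj_diag E x \<le> proj_diag D x"
proof -
  define f where "f = (\<Sum>e\<in>E. fun_scale (cnj (e x)) e)"
  have "f \<in> l2.span D"
    unfolding f_def using sub by (intro l2.span_sum l2.span_scale) auto
  then have exp: "f = (\<Sum>d\<in>D. fun_scale (l2_inner f d) d)"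
    by (rule orthonormal_expansion[OF D])
  have "l2_inner f f = complex_of_real (proj_diag E x)"
    unfolding f_def parseval[OF E] by (simp add: proj_diag_def)
  moreover have "l2_inner f f = complex_of_real (\<Sum>d\<in>D. (cmod (l2_inner f d))\<^sup>2)"
    using parseval[OF D, of "l2_inner f"] exp by simp
  ultimately have norm: "(\<Sum>d\<in>D. (cmod (l2_inner f d))\<^sup>2) = proj_diag E x"
    by (simp only: of_real_eq_iff)
  have "f x = complex_of_real (proj_diag E x)"
    by (simp add: f_def sum_fun_scale_apply proj_diag_def mult.commute flip: complex_norm_square)
  then have "(proj_diag E x)\<^sup>2 = (cmod (f x))\<^sup>2" by simp
  also have "\<dots> \<le> (\<Sum>d\<in>D. cmod (l2_inner f d) * cmod (d x))\<^sup>2"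
    by (subst exp, unfold sum_fun_scale_apply)
      (auto intro!: power_mono sum_norm_le simp: norm_mult)
  also have "\<dots> \<le> (\<Sum>d\<in>D. (cmod (l2_inner f d))\<^sup>2) * (\<Sum>d\<in>D. (cmod (d x))\<^sup>2)"
    by (rule Cauchy_Schwarz_ineq_sum)
  also have "\<dots> = proj_diag E x * proj_diag D x" by (simp add: norm proj_diag_def)
  finally have "proj_diag E x * proj_diag E x \<le> proj_diag E x * proj_diag D x"
    by (simp add: power2_eq_square)
  then show ?thesis
    using proj_diag_nonneg[of E x] proj_diag_nonneg[of D x]
    by (cases "proj_diag E x = 0") (auto simp: mult_le_cancel_left)
qed

text \<open>The trace of a projection is its rank: each unit vector contributes its squared norm
  1.\<close>

lemma proj_diag_has_sum:
  assumes "orthonormal E"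
  shows "(proj_diag E has_sum real (card E)) UNIV"
proof -
  have finite: "finite E" using assms by (simp add: orthonormal_def)
  have "((\<lambda>x. (cmod (e x))\<^sup>2) has_sum 1) UNIV" if "e \<in> E" for e
  proof -
    have "e \<in> l2" "l2_inner e e = 1" using assms that by (auto simp: orthonormal_def)
    then show ?thesis
      by (simp add: l2_def l2_inner_self has_sum_iff)
  qed
  with finite have "((\<lambda>x. \<Sum>e\<in>E. (cmod (e x))\<^sup>2) has_sum (\<Sum>e\<in>E. 1)) UNIV"
    by (induction E rule: finite_induct) (auto intro!: has_sum_add)
  then show ?thesis by (simp add: proj_diag_def[abs_def])
qed

lemma gram_schmidt:
  assumes "finite B" "B \<subseteq> l2" "l2.independent B"
  shows "\<exists>E. orthonormal E \<and> card E = card B \<and> l2.span E = l2.span B"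
  using assms
proof (induction B rule: finite_induct)
  case empty
  then show ?case by (intro exI[of _ "{}"]) (simp add: orthonormal_def)
next
  case (insert b B)
  then obtain E where E: "orthonormal E" "card E = card B" "l2.span E = l2.span B"
    using l2.independent_mono[of "insert b B" B] by auto
  have b: "b \<in> l2" "b \<notin> l2.span E"
    using insert.prems insert.hyps E(3) by (auto simp: l2.independent_insert)
  have El2: "E \<subseteq> l2" and finE: "finite E" using E(1) by (auto simp: orthonormal_def)
  \<comment> \<open>\<open>p\<close> is the projection of \<open>b\<close> to the span of
    \<open>E\<close>, and the remainder \<open>u\<close> is nonzero because \<open>b\<close> lies
    outside that span.\<close>
  define p where "p = (\<Sum>e\<in>E. fun_scale (l2_inner b e) e)"
  define u where "u = b - p"
  have p: "p \<in> l2.span E" "p \<in> l2"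
    unfolding p_def using El2
    by (intro l2.span_sum l2.span_scale l2.span_base l2_sum_closed, auto)+
  have u: "u \<in> l2" "u \<noteq> 0"
    using b p by (auto simp: u_def intro: l2.subspace_diff[OF l2.subspace_V])
  have orth: "l2_inner u e = 0" if "e \<in> E" for e
  proof -
    have "l2_inner b e = l2_inner (u + p) e" by (simp add: u_def)
    also have "\<dots> = l2_inner u e + l2_inner p e"
      using u p El2 that by (intro l2_inner_add) auto
    also have "l2_inner p e = l2_inner b e"
      unfolding p_def by (rule orthonormal_coefficient[OF E(1) that])
    finally show ?thesis by simp
  qed
  define r where "r = (\<Sum>\<^sub>\<infinity>x. (cmod (u x))\<^sup>2)"
  have ruu: "l2_inner u u = complex_of_real r" by (simp add: r_def l2_inner_self u(1))
  have "r \<ge> 0" unfolding r_def by (intro infsum_nonneg) simp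
  moreover have "r \<noteq> 0" using l2_inner_self_eq_0[OF u(1)] u(2) ruu by auto
  ultimately have "r > 0" by simp
  define c where "c = complex_of_real (1 / sqrt r)"
  define v where "v = fun_scale c u"
  have "c \<noteq> 0" using \<open>r > 0\<close> by (simp add: c_def)
  have "v \<in> l2" unfolding v_def using u by (intro l2.subspace_scale l2.subspace_V)
  have "l2_inner v v = c * (cnj c * l2_inner u u)"
    unfolding v_def l2_inner_scale
    by (subst l2_inner_commute) (simp add: l2_inner_scale ruu)
  also have "\<dots> = complex_of_real (1 / sqrt r * (1 / sqrt r * r))"
    by (simp only: ruu c_def complex_cnj_complex_of_real of_real_mult)
  also have "1 / sqrt r * (1 / sqrt r * r) = 1"
    using \<open>r > 0\<close> by (simp add: field_simps)
  finally have vv: "l2_inner v v = 1" by simp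
  have ve: "l2_inner v e = 0" "l2_inner e v = 0" if "e \<in> E" for e
    using orth[OF that] l2_inner_commute[of e v] by (simp_all add: v_def l2_inner_scale)
  have "orthonormal (insert v E)"
    using E(1) \<open>v \<in> l2\<close> vv ve by (auto simp: orthonormal_def)
  moreover have "v \<notin> E" using vv ve by force
  \<comment> \<open>Each of \<open>b\<close> and \<open>v\<close> is obtained from the other by
    scaling and adding a multiple of \<open>p\<close>, which lies in both spans.\<close>
  moreover have "l2.span (insert v E) = l2.span (insert b B)"
  proof -
    have bv: "b = fun_scale (1 / c) v + p"
      using \<open>c \<noteq> 0\<close> by (auto simp: u_def v_def fun_scale_def fun_eq_iff)
    have vb: "v = fun_scale c (b - p)" by (simp add: v_def u_def)
    have pE: "p \<in> l2.span (insert v E)" "p \<in> l2.span (insert b B)"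
      using p(1) E(3) l2.span_mono[OF subset_insertI, of E v] l2.span_mono[OF subset_insertI, of B b]
      by auto
    have "b \<in> l2.span (insert v E)"
      by (subst bv) (intro l2.span_add l2.span_scale l2.span_base pE, simp)
    moreover have "v \<in> l2.span (insert b B)"
      by (subst vb) (intro l2.span_diff l2.span_scale l2.span_base pE, simp)
    moreover have "E \<subseteq> l2.span (insert b B)" "B \<subseteq> l2.span (insert v E)"
      using E(3) l2.span_superset[of E] l2.span_superset[of B]
        l2.span_mono[OF subset_insertI, of E v] l2.span_mono[OF subset_insertI, of B b]
      by blast+
    ultimately show ?thesis
      by (intro subset_antisym l2.span_minimal l2.subspace_span) auto
  qed
  ultimately show ?case
    using E(2) finE insert.hyps by (intro exI[of _ "insert v E"]) auto
qed

lemma l2_orthonormal_basis: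
  assumes "finite B" "B \<subseteq> l2"
  shows "\<exists>E. orthonormal E \<and> card E = l2.dim (l2.span B) \<and> l2.span E = l2.span B"
proof -
  obtain C where C: "C \<subseteq> B" "l2.independent C" "B \<subseteq> l2.span C"
    using l2.maximal_independent_subset[of B] by auto
  then have span: "l2.span C = l2.span B"
    by (intro subset_antisym l2.span_mono l2.span_minimal l2.subspace_span)
  moreover have "finite C" "C \<subseteq> l2" using C assms by (auto intro: finite_subset)
  ultimately show ?thesis
    using gram_schmidt[of C] C(2) l2.dim_span_eq_card_independent[OF C(2)] by metis
qed

section \<open>Translations as unitary operators\<close>

lemma bij_plus_left: "bij ((+) (g::'g::group_add))"
  by (rule bij_betw_byWitness[where f' = "(+) (- g)"]) (auto simp flip: add.assoc)

lemma l2_inner_translation: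
  "l2_inner (translation g f) (translation g h) = l2_inner f h"
  unfolding l2_inner_def translation_def
  by (rule infsum_reindex_bij_betw[OF bij_plus_left])

lemma inj_translation: "inj (translation g)"
proof (rule injI, rule ext)
  fix f h :: "'a \<Rightarrow> complex" and x
  assume "translation g f = translation g h"
  then have "f (- g + (g + x)) = h (- g + (g + x))"
    unfolding translation_def by metis
  then show "f x = h x" by (simp flip: add.assoc)
qed

lemma orthonormal_translation:
  assumes "orthonormal E"
  shows "orthonormal (translation g ` E)"
  using assms injD[OF inj_translation[of g]]
  by (auto simp: orthonormal_def l2_inner_translation intro!: l2.act_closed)

text \<open>Translating the subspace conjugates its projection, which shifts the diagonal.
  Injectivity of translation keeps the summands distinct.\<close>

lemma proj_diag_translation: "proj_diag (translation g ` E) x = proj_diag E (- g + x)"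
  using inj_on_subset[OF inj_translation[of g]]
  by (subst proj_diag_def, subst sum.reindex) (auto simp: proj_diag_def translation_def)

subsection \<open>From algebraic amenability to an invariant mean\<close>

text \<open>Provides finite generators inside \<open>l2\<close>, from which an orthonormal basis of
  the sum of the translates is built.\<close>

lemma span_translates_finite_basis:
  assumes "finite S" "finite B" "l2.span B = W" "W \<subseteq> l2"
  shows "\<exists>B'. finite B' \<and> B' \<subseteq> l2 \<and> l2.span B' = l2.span (\<Union>g\<in>S. translation g ` W)"
proof -
  have lin: "Vector_Spaces.linear fun_scale fun_scale (translation g)" for g :: 'a
    by unfold_locales (auto simp: translation_def fun_scale_def fun_eq_iff algebra_simps)
  have image: "translation g ` W = l2.span (translation g ` B)" for g
    using Vector_Spaces.linear.axioms lin assms(3) module_hom.span_image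
    by (metis Vector_Spaces.linear_iff_module_hom)
  have B: "B \<subseteq> W" using assms(3) l2.span_superset by blast
  have "l2.span (\<Union>g\<in>S. translation g ` B) = l2.span (\<Union>g\<in>S. translation g ` W)"
  proof (intro subset_antisym l2.span_minimal l2.subspace_span)
    show "(\<Union>g\<in>S. translation g ` B) \<subseteq> l2.span (\<Union>g\<in>S. translation g ` W)"
      using B l2.span_superset[of "\<Union>g\<in>S. translation g ` W"] by blast
    show "(\<Union>g\<in>S. translation g ` W) \<subseteq> l2.span (\<Union>g\<in>S. translation g ` B)"
      unfolding image by (intro UN_least l2.span_mono) auto
  qed
  moreover have "finite (\<Union>g\<in>S. translation g ` B)" using assms(1,2) by simp
  moreover have "(\<Union>g\<in>S. translation g ` B) \<subseteq> l2"
    using B assms(4) l2.act_closed by blast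
  ultimately show ?thesis by blast
qed

text \<open>On \<open>A\<close> the difference \<open>p - q\<close> is at most \<open>d - q\<close>.
  The latter is nonnegative, so its sum over \<open>A\<close> is at most its total sum
  \<open>m - n\<close>; the bound is uniform in \<open>A\<close>.\<close>

lemma has_sum_dominated_diff:
  fixes p q d :: "'x \<Rightarrow> real"
  assumes "(p has_sum n) UNIV" "(q has_sum n) UNIV" "(d has_sum m) UNIV"
    and "\<And>x. 0 \<le> p x" "\<And>x. p x \<le> d x" "\<And>x. q x \<le> d x"
  shows "infsum p A - infsum q A \<le> m - n"
proof -
  have summable: "p summable_on X" "q summable_on X" "d summable_on X" for X
    using assms(1-3)[THEN has_sum_imp_summable] summable_on_subset_banach[of _ UNIV X] by auto
  have diff: "((\<lambda>x. u x - v x) has_sum a - b) X"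
    if "(u has_sum a) X" "(v has_sum b) X" for u v :: "'x \<Rightarrow> real" and a b X
    using has_sum_add[OF that(1) has_sum_uminusI[OF that(2)]] by simp
  then have dq: "(\<lambda>x. d x - q x) summable_on X" for X
    by (meson has_sum_imp_summable has_sum_infsum summable)
  have "infsum p A - infsum q A \<le> infsum d A - infsum q A"
    using assms(5) by (intro diff_right_mono infsum_mono summable)
  also have "\<dots> = (\<Sum>\<^sub>\<infinity>x\<in>A. d x - q x)"
    by (intro infsumI[symmetric] diff has_sum_infsum summable)
  also have "\<dots> \<le> (\<Sum>\<^sub>\<infinity>x. d x - q x)"
    using assms(6) by (intro infsum_mono2 dq) auto
  also have "\<dots> = m - n"
    using assms(2,3) by (intro infsumI diff)
  finally show ?thesis .
qed

text \<open>Stated as a set of set functions, so that a compactness argument can intersect these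
  sets over all \<open>g\<close> and \<epsilon>. Positivity comes from the cube of
  \<open>[0,1]\<close>-valued functions.\<close>

definition almost_invariant :: "'g::group_add \<Rightarrow> real \<Rightarrow> ('g set \<Rightarrow> real) set" where
  "almost_invariant g \<epsilon> = {\<mu>. \<mu> UNIV = 1 \<and> (\<forall>A B. A \<inter> B = {} \<longrightarrow> \<mu> (A \<union> B) = \<mu> A + \<mu> B) \<and>
    (\<forall>A. \<bar>\<mu> ((+) g ` A) - \<mu> A\<bar> \<le> \<epsilon>)}"

text \<open>The diagonal of the projection onto the sum of translates dominates that of
  \<open>W\<close> and its shifts, yet its total mass exceeds theirs by at most \<epsilon> times the
  dimension of \<open>W\<close>.\<close>

lemma l2_amenable_imp_almost_invariant:
  assumes amenable: "l2.algebraically_amenable TYPE('g::group_add)"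
    and "finite S" "\<epsilon> > 0"
  shows "\<exists>\<mu>::'g set \<Rightarrow> real. (\<forall>A. \<mu> A \<in> {0..1}) \<and> (\<forall>g\<in>S. \<mu> \<in> almost_invariant g \<epsilon>)"
proof -
  \<comment> \<open>The element 0 puts \<open>W\<close> itself into the sum. Inverses are used
    because translation by \<open>- g\<close> turns the diagonal \<open>?p\<close> into
    \<open>?p (g + x)\<close>, whose sum over \<open>A\<close> is that of \<open>?p\<close> over the
    translate of \<open>A\<close> by \<open>g\<close>.\<close>
  define S' where "S' = insert 0 (uminus ` S)"
  have "finite S'" using \<open>finite S\<close> by (simp add: S'_def)
  then obtain W B where W: "l2.subspace W" "W \<subseteq> l2" "finite B" "l2.span B = W" "l2.dim W > 0"
    "real (l2.dim (l2.span (\<Union>g\<in>S'. translation g ` W))) / real (l2.dim W) \<le> 1 + \<epsilon>"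
    using amenable \<open>\<epsilon> > 0\<close> unfolding l2.algebraically_amenable_def by meson
  define n where "n = real (l2.dim W)"
  have "n > 0" using W(5) by (simp add: n_def)
  have "B \<subseteq> l2" using W(2,4) l2.span_superset by blast
  then obtain E where E: "orthonormal E" "card E = l2.dim W" "l2.span E = W"
    using l2_orthonormal_basis[OF W(3)] W(4) by auto
  let ?U = "l2.span (\<Union>g\<in>S'. translation g ` W)"
  obtain B' where "finite B'" "B' \<subseteq> l2" "l2.span B' = ?U"
    using span_translates_finite_basis[OF \<open>finite S'\<close> W(3,4,2)] by blast
  then obtain D where D: "orthonormal D" "card D = l2.dim ?U" "l2.span D = ?U"
    using l2_orthonormal_basis[of B'] by auto
  have card_D: "real (card D) \<le> n + \<epsilon> * n"
    using W(6) \<open>n > 0\<close> D(2) by (simp add: n_def divide_le_eq algebra_simps)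
  let ?p = "proj_diag E" and ?d = "proj_diag D"
  have p_sum: "(?p has_sum n) UNIV"
    using proj_diag_has_sum[OF E(1)] E(2) by (simp add: n_def)
  have d_sum: "(?d has_sum real (card D)) UNIV" by (rule proj_diag_has_sum[OF D(1)])
  have translate_le: "?p (- g + x) \<le> ?d x" if "g \<in> S'" for g x
  proof -
    have "translation g ` E \<subseteq> l2.span D"
      unfolding D(3) using that E(3) l2.span_superset by (blast intro: l2.span_base)
    then show ?thesis
      using proj_diag_mono[OF orthonormal_translation[OF E(1)] D(1)]
      by (simp add: proj_diag_translation)
  qed
  define \<mu> where "\<mu> A = infsum ?p A / n" for A
  have summable: "?p summable_on A" for A
    using p_sum[THEN has_sum_imp_summable] summable_on_subset_banach[of _ UNIV A] by auto
  have UNIV: "\<mu> UNIV = 1" using infsumI[OF p_sum] \<open>n > 0\<close> by (simp add: \<mu>_def)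
  have add: "\<mu> (A \<union> A') = \<mu> A + \<mu> A'" if "A \<inter> A' = {}" for A A'
    using that by (simp add: \<mu>_def infsum_Un_disjoint summable add_divide_distrib)
  have nonneg: "0 \<le> \<mu> A" for A
    using \<open>n > 0\<close> by (simp add: \<mu>_def infsum_nonneg proj_diag_nonneg)
  have le1: "\<mu> A \<le> 1" for A
    using add[of A "- A"] nonneg[of "- A"] UNIV by simp
  have "\<bar>\<mu> ((+) g ` A) - \<mu> A\<bar> \<le> \<epsilon>" if "g \<in> S" for g A
  proof -
    let ?q = "\<lambda>x. ?p (g + x)"
    have q_sum: "(?q has_sum n) UNIV"
      using p_sum has_sum_reindex_bij_betw[OF bij_plus_left[of g], of ?p n] by simp
    have le: "?p x \<le> ?d x" "?q x \<le> ?d x" for x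
      using translate_le[of 0 x] translate_le[of "- g" x] that by (auto simp: S'_def)
    have image: "infsum ?p ((+) g ` A) = infsum ?q A"
      by (subst infsum_reindex) (auto simp: o_def inj_on_def)
    have "infsum ?p A - infsum ?q A \<le> real (card D) - n"
      by (rule has_sum_dominated_diff[OF p_sum q_sum d_sum proj_diag_nonneg le])
    moreover have "infsum ?q A - infsum ?p A \<le> real (card D) - n"
      by (rule has_sum_dominated_diff[OF q_sum p_sum d_sum proj_diag_nonneg le(2,1)])
    ultimately have "\<bar>infsum ?q A - infsum ?p A\<bar> \<le> \<epsilon> * n" using card_D by linarith
    then show ?thesis
      using \<open>n > 0\<close> by (simp add: \<mu>_def image flip: diff_divide_distrib) (simp add: field_simps)
  qed
  then show ?thesis
    using UNIV add nonneg le1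
    by (intro exI[of _ \<mu>]) (auto simp: almost_invariant_def)
qed

section \<open>Compactness and the invariant mean\<close>

text \<open>Each single condition involves the values at finitely many sets, and evaluation at a set
  is continuous in the product topology.\<close>

lemma closed_almost_invariant: "closed (almost_invariant g \<epsilon>)"
proof -
  have additive: "closed {\<mu>. A \<inter> B = {} \<longrightarrow> \<mu> (A \<union> B) = \<mu> A + (\<mu> B :: real)}" for A B :: "'a set"
  proof (cases "A \<inter> B = {}")
    case True
    have "closed {\<mu>. \<mu> (A \<union> B) = \<mu> A + (\<mu> B :: real)}"
      by (intro closed_Collect_eq continuous_intros continuous_on_product_coordinates)
    with True show ?thesis by simp
  qed simp
  show ?thesis
    unfolding almost_invariant_def
    by (intro closed_Collect_conj closed_Collect_all additive closed_Collect_eq closed_Collect_le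
        continuous_intros continuous_on_product_coordinates)
qed

text \<open>The cube \<open>K\<close> is compact by Tychonoff's theorem, and finitely many
  almost-invariance conditions are met at once by using the smallest tolerance. A common point of
  all of them is invariant, as its defect is below every \<delta>.\<close>

lemma l2_amenable_imp_amenable_group:
  assumes "l2.algebraically_amenable TYPE('g::group_add)"
  shows "amenable_group TYPE('g)"
proof -
  define K where "K = (\<Pi>\<^sub>E A\<in>(UNIV :: 'g set set). {0..1::real})"
  have "compact K"
    unfolding K_def using compactin_PiE[of "\<lambda>_::'g set. euclideanreal" UNIV "\<lambda>_. {0..1}"]
    by (simp add: euclidean_product_topology)
  let ?I = "(UNIV :: 'g set) \<times> {0::real<..}"
  have "K \<inter> (\<Inter>i\<in>?I. case_prod almost_invariant i) \<noteq> {}"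
  proof (rule compact_imp_fip_image[OF \<open>compact K\<close>])
    fix i :: "'g \<times> real"
    show "closed (case_prod almost_invariant i)"
      by (cases i) (simp add: closed_almost_invariant)
  next
    fix J assume J: "finite J" "J \<subseteq> ?I"
    \<comment> \<open>Inserting 1 keeps the minimum meaningful when \<open>J\<close> is
      empty.\<close>
    define \<epsilon> where "\<epsilon> = Min (insert 1 (snd ` J))"
    have "\<epsilon> > 0" using J by (auto simp: \<epsilon>_def)
    have \<epsilon>_le: "\<epsilon> \<le> \<delta>" if "(g, \<delta>) \<in> J" for g \<delta>
      unfolding \<epsilon>_def using J(1) that by (intro Min_le) force+
    obtain \<mu> :: "'g set \<Rightarrow> real" where \<mu>: "\<And>A. \<mu> A \<in> {0..1}"
      "\<And>g. g \<in> fst ` J \<Longrightarrow> \<mu> \<in> almost_invariant g \<epsilon>"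
      using l2_amenable_imp_almost_invariant[OF assms _ \<open>\<epsilon> > 0\<close>, of "fst ` J"] J(1) by blast
    have "\<mu> \<in> almost_invariant g \<delta>" if "(g, \<delta>) \<in> J" for g \<delta>
    proof -
      have "\<mu> \<in> almost_invariant g \<epsilon>" using that by (intro \<mu>) force
      then show ?thesis
        using \<epsilon>_le[OF that] by (auto simp: almost_invariant_def intro: order_trans)
    qed
    moreover have "\<mu> \<in> K" using \<mu>(1) by (simp add: K_def PiE_iff)
    ultimately show "K \<inter> (\<Inter>i\<in>J. case_prod almost_invariant i) \<noteq> {}" by blast
  qed
  then obtain \<mu> where \<mu>: "\<mu> \<in> K" "\<And>g \<delta>. \<delta> > 0 \<Longrightarrow> \<mu> \<in> almost_invariant g \<delta>"
    by auto
  have "\<mu> ((+) g ` A) = \<mu> A" for g A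
  proof -
    have "\<bar>\<mu> ((+) g ` A) - \<mu> A\<bar> \<le> 0 + \<delta>" if "\<delta> > 0" for \<delta>
      using \<mu>(2)[OF that] by (auto simp: almost_invariant_def)
    then have "\<bar>\<mu> ((+) g ` A) - \<mu> A\<bar> \<le> 0" by (rule field_le_epsilon)
    then show ?thesis by simp
  qed
  moreover have "0 \<le> \<mu> A" for A using \<mu>(1) by (simp add: K_def PiE_iff)
  ultimately show ?thesis
    using \<mu>(2)[of 1] unfolding amenable_group_def almost_invariant_def
    by (intro exI[of _ \<mu>]) auto
qed

theorem proposition4p2:
  shows "(unital_algebra.amenable
            (group_algebra_scale ::
              complex \<Rightarrow> 'g::{group_add, countable} group_algebra \<Rightarrow> 'g group_algebra)
          \<longleftrightarrow> amenable_group TYPE('g)) \<and>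
         (linear_representation.algebraically_amenable
            fun_scale l2 (translation :: 'g \<Rightarrow> ('g \<Rightarrow> complex) \<Rightarrow> 'g \<Rightarrow> complex)
          \<longleftrightarrow> amenable_group TYPE('g))"
proof (intro conjI iffI)
  assume "amenable_group TYPE('g)"
  then show "group_algebra.amenable TYPE('g)"
    by (intro folner_imp_group_algebra_amenable amenable_group_imp_folner)
  then show "l2.algebraically_amenable TYPE('g)"
    by (rule group_algebra_amenable_imp_l2)
next
  assume "l2.algebraically_amenable TYPE('g)"
  then show "amenable_group TYPE('g)" by (rule l2_amenable_imp_amenable_group)
next
  assume "group_algebra.amenable TYPE('g)"
  then show "amenable_group TYPE('g)"
    by (intro l2_amenable_imp_amenable_group group_algebra_amenable_imp_l2)
qed

end
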